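(* For every integer $n\ge 0$ and $1\le\ell\le n+1$, $$\sum_{k=0}^{n}T(n,k)\binom{n-k}{n+1-\ell}=\sum_{j=1}^{\ell}\binom{\ell-1}{j-1}(-1)^{j-\ell}(4j-1)^{n},$$ $$\sum_{k=0}^{n}T(n,k)\binom{k}{n+1-\ell}=\sum_{j=1}^{\ell}\binom{\ell-1}{j-1}(-1)^{j-\ell}(4j-3)^{n}.$$ Consequently, for all $n\ge 1$ and $1\le\ell\le n+1$, $$E_{\ell,1}(n)=4^{n}P_{n+1,\ell}\!\Big(\tfrac14\Big),\qquad E_{\ell,3}(n)=-4^{n}P_{n+1,\ell}\!\Big(\tfrac34\Big),$$ where $$E_{\ell,b}(n)=\sum_{k=0}^{n}T(n,k)\Big[A_{n+1,\,4(n-k)+1}(\ell,b)-A_{n+1,\,4k+3}(\ell,b)\Big]\qquad(b\in\{1,3\}).$$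
   Context: Generalised Eulerian weights: integers $T(n,k)$ with $T(0,0)=1$, $T(n,k)=0$ for $k<0$ or $k>n$, and for $n\ge 0$, $0\le k\le n+1$, $$T(n+1,k)=\big(4(n-k)+5\big)T(n,k-1)+(4k+3)T(n,k).$$ Polynomials: for integers $k,\ell\ge 1$, $P_{k,\ell}(x)=\sum_{j=1}^{\ell}\binom{\ell-1}{j-1}(-1)^{j+k}(j-x)^{k-1}$. Coefficients: for $m\ge 1$, odd $r\ge 1$, $1\le\ell\le m$ and $b\in\{1,3\}$, the integers $A_{m,r}(\ell,b)$ are defined recursively as follows. (i) For $r\in\{1,3\}$: $A_{m,r}(\ell,b)=1$ if $\ell=m$ and $r=b$, and $A_{m,r}(\ell,b)=0$ otherwise. (ii) For odd $r\ge 5$: $A_{m,r}(\ell,b)=A_{m,r-4}(\ell,b)-A_{m-1,r-4}(\ell,b)$. Convention: $A_{m,r}(\ell,b)=0$ whenever $\ell>m$ (in particular $A_{0,r}(\ell,b)=0$ for all $\ell\ge 1$). *)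

theory Defs
  imports Complex_Main "HOL-Computational_Algebra.Polynomial"
begin

fun gen_eulerian :: "nat \<Rightarrow> int \<Rightarrow> int" where
  "gen_eulerian 0 k = (if k = 0 then 1 else 0)"
| "gen_eulerian (Suc n) k =
     (if 0 \<le> k \<and> k \<le> int n + 1
      then (4 * (int n - k) + 5) * gen_eulerian n (k - 1) + (4 * k + 3) * gen_eulerian n k
      else 0)"

definition P_poly :: "nat \<Rightarrow> nat \<Rightarrow> real poly" where
  "P_poly k l =
     (\<Sum>j=1..l. smult (of_nat ((l - 1) choose (j - 1)) * (-1) ^ (j + k)) ([:of_nat j, -1:] ^ (k - 1)))"

text \<open>
  \<open>A_coeff m r l b\<close> is \<open>A\<^sub>m\<^sub>,\<^sub>r(l,b)\<close>. The guard \<open>1 \<le> l \<le> m\<close> builds in the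
  convention that the coefficient vanishes for \<open>l > m\<close>; in particular \<open>m \<ge> 1\<close> in the other
  branches, so \<open>m - 1\<close> is never truncated. Even \<open>r\<close> and \<open>l = 0\<close> lie outside the domain and get
  the value 0.
\<close>

fun A_coeff :: "nat \<Rightarrow> nat \<Rightarrow> nat \<Rightarrow> nat \<Rightarrow> int" where
  "A_coeff m r l b =
     (if \<not> (1 \<le> l \<and> l \<le> m) then 0
      else if r = 1 \<or> r = 3 then (if l = m \<and> r = b then 1 else 0)
      else if odd r \<and> r \<ge> 5 then A_coeff m (r - 4) l b - A_coeff (m - 1) (r - 4) l b
      else 0)"

declare A_coeff.simps [simp del]

definition E_coeff :: "nat \<Rightarrow> nat \<Rightarrow> nat \<Rightarrow> int" where
  "E_coeff l b n =
     (\<Sum>k=0..n. gen_eulerian n (int k) *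
        (A_coeff (n + 1) (4 * (n - k) + 1) l b - A_coeff (n + 1) (4 * k + 3) l b))"

end

theory Submission imports Defs begin

text \<open>
  Both binomial moments of a row \<open>T(n, 0), \<dots>, T(n, n)\<close> are iterated finite differences at \<open>0\<close>:
  the one against \<open>(n - k) choose s\<close> is \<open>\<Delta>^(n - s)\<close> of \<open>x \<mapsto> (4 * x + 3) ^ n\<close>, the one against
  \<open>k choose s\<close> is \<open>\<Delta>^(n - s)\<close> of \<open>x \<mapsto> (4 * x + 1) ^ n\<close>. The reason is that the two sides obey
  the same recurrence in \<open>n\<close>. For the moments, pushing a test function through the recurrence for
  \<open>T\<close> (lemma \<open>gen_eulerian_sum_Suc\<close>) replaces it by a combination of two of its shifts, and for a
  binomial test function this is again a combination of two binomials (lemma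
  \<open>binomial_transfer\<close>). For the differences, the recurrence is the Leibniz rule for
  multiplication by \<open>d * x + c\<close> (lemma \<open>fin_diff_Suc\<close>). Reversing \<open>k \<mapsto> n - k\<close> exchanges the
  offsets \<open>1\<close> and \<open>3\<close> in the recurrence for \<open>T\<close>; as these add up to the step \<open>4\<close>, a single
  computation with offsets \<open>a + c = d\<close> covers both moments.

  For the last two identities, unrolling the recursion of \<open>A_coeff\<close> applies the backward
  difference in \<open>m\<close> repeatedly to an indicator function. So \<open>A_coeff m (4 * q + c) l b\<close>, with
  \<open>c\<close> equal to \<open>1\<close> or \<open>3\<close>, is the signed binomial \<open>(-1) ^ (m - l) * (q choose (m - l))\<close> for
  \<open>b = c\<close> and \<open>l \<le> m\<close>, and zero otherwise (lemma \<open>A_coeff_closed\<close>). Hence only one of the two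
  terms in \<open>E_coeff\<close> survives and gives one of the two moments up to sign, while evaluating \<open>P_poly\<close>
  at \<open>1 / 4\<close> or \<open>3 / 4\<close> gives the matching difference up to sign and the factor \<open>4 ^ n\<close>.
\<close>

section \<open>Iterated differences of powers of a linear function\<close>

text \<open>The \<open>D\<close>-th forward difference at \<open>0\<close> of \<open>x \<mapsto> (d * x + c) ^ n\<close>.\<close>

definition fin_diff :: "int \<Rightarrow> int \<Rightarrow> nat \<Rightarrow> nat \<Rightarrow> int" where
  "fin_diff d c n D = (\<Sum>i=0..D. int (D choose i) * (-1) ^ (D - i) * (d * int i + c) ^ n)"

lemma fin_diff_0: "fin_diff d c 0 D = (if D = 0 then 1 else 0)"
proof -
  have "fin_diff d c 0 D = (1 + (-1)) ^ D"
    unfolding fin_diff_def binomial_ring by (simp add: atLeast0AtMost)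
  then show ?thesis by (simp add: power_0_left)
qed

text \<open>
  A Leibniz rule: write one factor \<open>d * i + c\<close> as \<open>(d * D + c) - d * (D - i)\<close> and absorb
  \<open>D - i\<close> into the binomial coefficient, which lowers the order of the difference by one.
\<close>

lemma fin_diff_Suc:
  "fin_diff d c (Suc n) D
     = (d * int D + c) * fin_diff d c n D + d * int D * fin_diff d c n (D - 1)"
proof (cases D)
  case 0
  then show ?thesis by (simp add: fin_diff_def)
next
  case (Suc E)
  let ?t = "\<lambda>D i. int (D choose i) * (-1) ^ (D - i) * (d * int i + c) ^ n"
  have absorb: "int (D - i) * ?t D i = - (int D * ?t E i)" if "i \<le> E" for i
  proof -
    have "(D - i) * (D choose i) = D * (E choose i)"
      using binomial_absorb_comp[of D i] Suc by simp
    then have "int (D - i) * int (D choose i) = int D * int (E choose i)"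
      by (metis of_nat_mult)
    moreover have "(-1) ^ (D - i) = - ((-1 :: int) ^ (E - i))"
      using that Suc by (simp add: Suc_diff_le)
    ultimately show ?thesis by (simp add: mult.assoc[symmetric])
  qed
  have "fin_diff d c (Suc n) D
          = (\<Sum>i=0..D. (d * int D + c) * ?t D i - d * (int (D - i) * ?t D i))"
    unfolding fin_diff_def
    by (intro sum.cong refl) (auto simp: of_nat_diff algebra_simps)
  also have "\<dots> = (d * int D + c) * fin_diff d c n D - d * (\<Sum>i=0..D. int (D - i) * ?t D i)"
    by (simp only: sum_subtractf sum_distrib_left[symmetric] fin_diff_def)
  also have "(\<Sum>i=0..D. int (D - i) * ?t D i) = (\<Sum>i=0..E. int (D - i) * ?t D i)"
    using Suc by simp
  also have "\<dots> = (\<Sum>i=0..E. - (int D * ?t E i))"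
    by (rule sum.cong[OF refl], rule absorb) simp
  also have "\<dots> = - (int D * fin_diff d c n E)"
    by (simp only: sum_negf sum_distrib_left[symmetric] fin_diff_def)
  finally show ?thesis using Suc by simp
qed

text \<open>Differencing a polynomial more often than its degree gives zero.\<close>

lemma fin_diff_eq_0: "n < D \<Longrightarrow> fin_diff d c n D = 0"
  by (induction n arbitrary: D) (auto simp: fin_diff_0 fin_diff_Suc)

text \<open>
  The recurrence of the binomial moments determines them. It matches \<open>fin_diff_Suc\<close> for the
  order \<open>D = n - s\<close>; for \<open>s = 0\<close> one of the two terms is missing, in agreement with
  \<open>fin_diff_eq_0\<close>.
\<close>

lemma fin_diff_unique:
  assumes "S 0 0 = 1"
    and "\<And>n. S (Suc n) 0 = d * int (Suc n) * S n 0"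
    and "\<And>n s. S (Suc n) (Suc s)
           = d * (int n - int s) * S n (Suc s) + (d * (int n - int s) + c) * S n s"
    and "s \<le> n"
  shows "S n s = fin_diff d c n (n - s)"
  using \<open>s \<le> n\<close>
proof (induction n arbitrary: s)
  case 0
  then show ?case using assms(1) by (simp add: fin_diff_0)
next
  case (Suc n)
  show ?case
  proof (cases s)
    case 0
    then show ?thesis using Suc.IH[of 0] by (simp add: assms(2) fin_diff_Suc fin_diff_eq_0)
  next
    case (Suc s')
    with Suc.prems have le: "s' \<le> n" by simp
    show ?thesis
    proof (cases "s' = n")
      case True
      then show ?thesis using Suc Suc.IH[OF le] by (simp add: assms(3) fin_diff_Suc)
    next
      case False
      with le have "Suc s' \<le> n" by simp
      then show ?thesis
        using Suc Suc.IH[OF le] Suc.IH[of "Suc s'"]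
        by (simp add: assms(3) fin_diff_Suc of_nat_diff)
    qed
  qed
qed

section \<open>Binomial moments of the generalised Eulerian weights\<close>

lemma gen_eulerian_outside: "k < 0 \<or> k > int n \<Longrightarrow> gen_eulerian n k = 0"
  by (cases n) auto

text \<open>
  The dual form of the recurrence: it describes what one step in \<open>n\<close> does to the test function
  \<open>f\<close> instead of to the weights.
\<close>

lemma gen_eulerian_sum_Suc:
  "(\<Sum>k=0..Suc n. gen_eulerian (Suc n) (int k) * f k)
     = (\<Sum>k=0..n. gen_eulerian n (int k) *
          ((4 * (int n - int k) + 1) * f (Suc k) + (4 * int k + 3) * f k))"
proof -
  have "(\<Sum>k=0..Suc n. gen_eulerian (Suc n) (int k) * f k)
      = (\<Sum>k=0..Suc n. (4 * (int n - int k) + 5) * gen_eulerian n (int k - 1) * f k)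
        + (\<Sum>k=0..Suc n. (4 * int k + 3) * gen_eulerian n (int k) * f k)"
    by (subst sum.distrib[symmetric], rule sum.cong) (auto simp: algebra_simps)
  also have "(\<Sum>k=0..Suc n. (4 * (int n - int k) + 5) * gen_eulerian n (int k - 1) * f k)
      = (\<Sum>k=0..n. (4 * (int n - int k) + 1) * gen_eulerian n (int k) * f (Suc k))"
    by (simp add: sum.atLeast0_atMost_Suc_shift gen_eulerian_outside algebra_simps
             del: sum.cl_ivl_Suc)
  also have "(\<Sum>k=0..Suc n. (4 * int k + 3) * gen_eulerian n (int k) * f k)
      = (\<Sum>k=0..n. (4 * int k + 3) * gen_eulerian n (int k) * f k)"
    by (simp add: gen_eulerian_outside)
  finally show ?thesis
    by (simp add: sum.distrib[symmetric] algebra_simps)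
qed

text \<open>
  By Pascal's rule the left-hand side is a combination of \<open>u choose Suc s\<close> and \<open>u choose s\<close> with
  coefficients linear in \<open>u\<close>. In the first one \<open>u\<close> cancels; in the second one it is removed by
  \<open>u * (u choose s) = Suc s * (u choose Suc s) + s * (u choose s)\<close>.
\<close>

lemma binomial_transfer:
  fixes a c d N :: int
  assumes "a + c = d"
  shows "(d * int u + a) * int (u choose Suc s) + (d * (N - int u) + c) * int (Suc u choose Suc s)
     = d * (N - int s) * int (u choose Suc s) + (d * (N - int s) + c) * int (u choose s)"
proof -
  have "u * (u choose s) = Suc s * (u choose Suc s) + s * (u choose s)"
  proof (cases "s \<le> u")
    case True
    have "Suc s * (u choose Suc s) = (u - s) * (u choose s)"
      using binomial_absorb_comp[of u s] binomial_absorption[of s u] by simp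
    with True show ?thesis by (simp add: add_mult_distrib[symmetric] del: mult_Suc)
  next
    case False
    then show ?thesis by (simp add: binomial_eq_0)
  qed
  then have "int u * int (u choose s)
      = (int s + 1) * int (u choose Suc s) + int s * int (u choose s)"
    by (metis of_nat_Suc of_nat_add of_nat_mult add.commute)
  moreover have "d = a + c" using assms by simp
  ultimately show ?thesis by simp algebra
qed

lemma gen_eulerian_codegree_moment:
  assumes "s \<le> n"
  shows "(\<Sum>k=0..n. gen_eulerian n (int k) * int ((n - k) choose s)) = fin_diff 4 3 n (n - s)"
proof -
  define S where "S = (\<lambda>n s. \<Sum>k=0..n. gen_eulerian n (int k) * int ((n - k) choose s))"
  have step: "S (Suc n) s = (\<Sum>k=0..n. gen_eulerian n (int k) *
      ((4 * int (n - k) + 1) * int ((n - k) choose s)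
       + (4 * (int n - int (n - k)) + 3) * int (Suc (n - k) choose s)))" for n s
    unfolding S_def gen_eulerian_sum_Suc
    by (intro sum.cong refl) (simp add: Suc_diff_le of_nat_diff)
  have "S n s = fin_diff 4 3 n (n - s)"
  proof (rule fin_diff_unique[OF _ _ _ assms])
    show "S 0 0 = 1" by (simp add: S_def)
    show "S (Suc n) 0 = 4 * int (Suc n) * S n 0" for n
      by (simp add: step)
         (simp add: S_def sum_distrib_left sum.distrib[symmetric] algebra_simps)
    show "S (Suc n) (Suc s)
        = 4 * (int n - int s) * S n (Suc s) + (4 * (int n - int s) + 3) * S n s" for n s
      unfolding step
      by (subst binomial_transfer)
         (simp_all add: S_def sum_distrib_left sum.distrib[symmetric] algebra_simps)
  qed
  then show ?thesis by (simp add: S_def)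
qed

lemma gen_eulerian_degree_moment:
  assumes "s \<le> n"
  shows "(\<Sum>k=0..n. gen_eulerian n (int k) * int (k choose s)) = fin_diff 4 1 n (n - s)"
proof -
  define S where "S = (\<lambda>n s. \<Sum>k=0..n. gen_eulerian n (int k) * int (k choose s))"
  have step: "S (Suc n) s = (\<Sum>k=0..n. gen_eulerian n (int k) *
      ((4 * int k + 3) * int (k choose s)
       + (4 * (int n - int k) + 1) * int (Suc k choose s)))" for n s
    unfolding S_def gen_eulerian_sum_Suc
    by (intro sum.cong refl) (simp add: add.commute)
  have "S n s = fin_diff 4 1 n (n - s)"
  proof (rule fin_diff_unique[OF _ _ _ assms])
    show "S 0 0 = 1" by (simp add: S_def)
    show "S (Suc n) 0 = 4 * int (Suc n) * S n 0" for n
      by (simp add: step)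
         (simp add: S_def sum_distrib_left sum.distrib[symmetric] algebra_simps)
    show "S (Suc n) (Suc s)
        = 4 * (int n - int s) * S n (Suc s) + (4 * (int n - int s) + 1) * S n s" for n s
      unfolding step
      by (subst binomial_transfer)
         (simp_all add: S_def sum_distrib_left sum.distrib[symmetric] algebra_simps)
  qed
  then show ?thesis by (simp add: S_def)
qed

section \<open>The coefficients in closed form\<close>

text \<open>
  The induction step is Pascal's rule. It has to pass through \<open>m = l\<close>, where the recursion
  reaches \<open>A_coeff (l - 1) r l b = 0\<close>.
\<close>

lemma A_coeff_closed:
  assumes "1 \<le> l" and "c = 1 \<or> c = 3"
  shows "A_coeff m (4 * q + c) l b
     = (if l \<le> m \<and> b = c then (-1) ^ (m - l) * int (q choose (m - l)) else 0)"
proof (induction q arbitrary: m)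
  case 0
  show ?case using assms by (subst A_coeff.simps) (auto simp: binomial_eq_0)
next
  case (Suc q)
  have "odd (4 * Suc q + c)" using assms(2) by auto
  then have rec: "A_coeff m (4 * Suc q + c) l b
      = (if l \<le> m then A_coeff m (4 * q + c) l b - A_coeff (m - 1) (4 * q + c) l b else 0)"
    using assms by (subst A_coeff.simps) auto
  show ?case
  proof (cases "l < m")
    case True
    then obtain t where "m = Suc (l + t)" using less_imp_Suc_add by blast
    then show ?thesis unfolding rec Suc.IH by (simp add: algebra_simps)
  next
    case False
    then show ?thesis unfolding rec Suc.IH using assms(1) by auto
  qed
qed

lemma E_coeff_moment:
  assumes "1 \<le> l" and "l \<le> n + 1"
  shows "E_coeff l 1 n = (-1) ^ (n + 1 - l) *
           (\<Sum>k=0..n. gen_eulerian n (int k) * int ((n - k) choose (n + 1 - l)))"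
    and "E_coeff l 3 n = - ((-1) ^ (n + 1 - l)) *
           (\<Sum>k=0..n. gen_eulerian n (int k) * int (k choose (n + 1 - l)))"
  unfolding E_coeff_def A_coeff_closed[OF assms(1) disjI1[OF refl]]
    A_coeff_closed[OF assms(1) disjI2[OF refl]]
  using assms(2) by (simp_all add: sum_distrib_left sum_negf[symmetric] mult_ac)

text \<open>The sign \<open>(-1) ^ (n + 1 - l)\<close> turns \<open>(-1) ^ (l - j)\<close> into the sign \<open>(-1) ^ (j + n + 1)\<close>.\<close>

lemma P_poly_eval:
  assumes "1 \<le> l" and "l \<le> n + 1"
  shows "real_of_int ((-1) ^ (n + 1 - l) *
           (\<Sum>j=1..l. int ((l - 1) choose (j - 1)) * (-1) ^ (l - j) * (4 * int j - c) ^ n))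
         = 4 ^ n * poly (P_poly (n + 1) l) (real_of_int c / 4)"
proof -
  have sign: "(-1 :: real) ^ (n + 1 - l) * (-1) ^ (l - j) = (-1) ^ (j + (n + 1))"
    if "j \<le> l" for j
  proof -
    have "j + (n + 1) = (n + 1 - l) + (l - j) + 2 * j" using that assms by simp
    then show ?thesis by (simp only: power_add power_mult) simp
  qed
  have scale: "4 ^ n * (real j - real_of_int c / 4) ^ n = (4 * real j - real_of_int c) ^ n" for j
    by (simp add: power_mult_distrib[symmetric] right_diff_distrib)
  have "real_of_int ((-1) ^ (n + 1 - l) *
          (\<Sum>j=1..l. int ((l - 1) choose (j - 1)) * (-1) ^ (l - j) * (4 * int j - c) ^ n))
      = (\<Sum>j=1..l. real ((l - 1) choose (j - 1)) * ((-1) ^ (n + 1 - l) * (-1) ^ (l - j))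
           * (4 * real j - real_of_int c) ^ n)"
    by (simp add: sum_distrib_left mult_ac)
  also have "\<dots> = (\<Sum>j=1..l. 4 ^ n * (real ((l - 1) choose (j - 1)) * (-1) ^ (j + (n + 1))
           * (real j - real_of_int c / 4) ^ n))"
    by (intro sum.cong refl) (simp only: atLeastAtMost_iff sign scale[symmetric], simp only: mult_ac)
  also have "\<dots> = 4 ^ n * poly (P_poly (n + 1) l) (real_of_int c / 4)"
    by (simp add: P_poly_def poly_sum sum_distrib_left)
  finally show ?thesis .
qed

lemma fin_diff_shifted_index:
  assumes "1 \<le> l"
  shows "fin_diff d c n (l - 1)
     = (\<Sum>j=1..l. int ((l - 1) choose (j - 1)) * (-1) ^ (l - j) * (d * int j - (d - c)) ^ n)"
proof -
  obtain D where "l = Suc D" using assms by (cases l) auto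
  then show ?thesis
    by (simp add: fin_diff_def sum.shift_bounds_cl_Suc_ivl algebra_simps del: sum.cl_ivl_Suc)
qed

theorem lemma10p2:
  fixes n l :: nat
  assumes "1 \<le> l" and "l \<le> n + 1"
  shows "(\<Sum>k=0..n. gen_eulerian n (int k) * int ((n - k) choose (n + 1 - l)))
           = (\<Sum>j=1..l. int ((l - 1) choose (j - 1)) * (-1) ^ (l - j) * (4 * int j - 1) ^ n)
       \<and> (\<Sum>k=0..n. gen_eulerian n (int k) * int (k choose (n + 1 - l)))
           = (\<Sum>j=1..l. int ((l - 1) choose (j - 1)) * (-1) ^ (l - j) * (4 * int j - 3) ^ n)
       \<and> (n \<ge> 1 \<longrightarrow>
            real_of_int (E_coeff l 1 n) = 4 ^ n * poly (P_poly (n + 1) l) (1 / 4)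
          \<and> real_of_int (E_coeff l 3 n) = - (4 ^ n) * poly (P_poly (n + 1) l) (3 / 4))"
proof -
  have s: "n + 1 - l \<le> n" "n - (n + 1 - l) = l - 1" using assms by auto
  have m1: "(\<Sum>k=0..n. gen_eulerian n (int k) * int ((n - k) choose (n + 1 - l)))
      = (\<Sum>j=1..l. int ((l - 1) choose (j - 1)) * (-1) ^ (l - j) * (4 * int j - 1) ^ n)"
    using gen_eulerian_codegree_moment[OF s(1)] fin_diff_shifted_index[OF assms(1), of 4 3 n] s(2)
    by simp
  have m3: "(\<Sum>k=0..n. gen_eulerian n (int k) * int (k choose (n + 1 - l)))
      = (\<Sum>j=1..l. int ((l - 1) choose (j - 1)) * (-1) ^ (l - j) * (4 * int j - 3) ^ n)"
    using gen_eulerian_degree_moment[OF s(1)] fin_diff_shifted_index[OF assms(1), of 4 1 n] s(2)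
    by simp
  have "real_of_int (E_coeff l 1 n) = 4 ^ n * poly (P_poly (n + 1) l) (1 / 4)"
    using P_poly_eval[OF assms, of 1] by (simp only: E_coeff_moment(1)[OF assms] m1 of_int_1)
  moreover have "real_of_int (E_coeff l 3 n) = - (4 ^ n) * poly (P_poly (n + 1) l) (3 / 4)"
    using P_poly_eval[OF assms, of 3]
    by (simp only: E_coeff_moment(2)[OF assms] m3 of_int_numeral mult_minus_left of_int_minus)
  ultimately show ?thesis using m1 m3 by blast
qed

end
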